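(* Let $A=(a_{ij})$ be a real $m\times n$ matrix with $m\ge n$ and $\operatorname{rank}(A)=n$, which is type-I staircase and ASSR with signature $\varepsilon=(\varepsilon_1,\dots,\varepsilon_n)$, and let $A=QR$ be a factorization with $Q$ a real $m\times n$ matrix satisfying $Q^TQ=I_n$ and $R$ an $n\times n$ upper triangular matrix whose diagonal entries are all strictly positive. Then $R$ is TP, and whenever $\det A[\alpha|\beta]$ (with $\alpha\in Q^0_{k,m}$, $\beta\in Q^0_{k,n}$) is a column boundary minor of $A$, $\det Q[\alpha|\beta]$ is a column generalized boundary minor of $Q$ and $\varepsilon_k\det Q[\alpha|\beta]>0$.
   Context: $Q_{k,n}$ is the set of strictly increasing sequences of $k$ natural numbers not greater than $n$, and $Q^0_{k,n}$ the subset of sequences of $k$ consecutive integers; $A[\alpha|\beta]$ is the submatrix with rows $\alpha$ and columns $\beta$, and $A[\alpha|j]$ is the column vector of entries $a_{\alpha_i,j}$. An $m\times n$ real matrix $A=(a_{ij})$ is type-I staircase if: (i) $a_{ii}\neq 0$ for all $i\le\min\{m,n\}$; (ii) if $i>j$ and $a_{ij}=0$ then $a_{kl}=0$ for all $k\ge i$, $l\le j$; (iii) if $i<j$ and $a_{ij}=0$ then $a_{kl}=0$ for all $k\le i$, $l\ge j$. With $P_m$ the backward identity matrix, $A$ is type-II staircase if $P_mA$ is type-I staircase. A submatrix $A[\alpha|\beta]$ is nontrivial if $a_{\alpha_i,\beta_i}\ne0$ for all $i$. A matrix with $\operatorname{rank}=r=\min\{m,n\}$ is ASSR with signature $\varepsilon\in\{\pm1\}^r$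 if it is type-I or type-II staircase and every nontrivial minor satisfies $\varepsilon_k\det A[\alpha|\beta]>0$ ($\alpha\in Q_{k,m}$, $\beta\in Q_{k,n}$, $k\le r$); it is SR with signature $\varepsilon$ if it is type-I or type-II staircase and $\varepsilon_k\det A[\alpha|\beta]\ge0$ for all such $\alpha,\beta,k$; it is TP if it is SR with signature $(1,\dots,1)$. For type-I staircase $A$, a submatrix $A[\alpha|\beta]$ with $\alpha\in Q^0_{k,m}$, $\beta\in Q^0_{k,n}$ and $a_{\alpha_i,\beta_i}\ne0$ for all $i$ is a column boundary submatrix if $\beta_1=1$, or $\beta_1>1$ and $A[\alpha|\beta_1-1]=0$. For any matrix $M$, a submatrix $M[\alpha|\beta]$ with $\alpha\in Q^0_{k,m}$, $\beta\in Q^0_{k,n}$ and $m_{\alpha_1,\beta_1}\ne0$ is a column generalized boundary submatrix if $\beta_1=1$, or $\beta_1>1$ and $M[\alpha|\beta_1-1]=0$. Their determinants are column boundary minors and column generalized boundary minors, respectively. *)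

theory Defs
  imports Jordan_Normal_Form.DL_Rank_Submatrix
begin

text \<open>
  Matrices are indexed from 0: rows of an m by n matrix by 0, ..., m - 1 and columns by
  0, ..., n - 1, so an index sequence takes its values in this range, and the condition that the
  first column index is 1 becomes \<open>\<beta> ! 0 = 0\<close>.  The entries of a signature keep the numbering
  \<open>\<epsilon> 1, ..., \<epsilon> r\<close>, since \<open>\<epsilon> k\<close> is the sign of the minors of order k.
\<close>

definition incr_seqs :: "nat \<Rightarrow> nat \<Rightarrow> nat list set" where
  "incr_seqs k n = {\<alpha>. length \<alpha> = k \<and> sorted_wrt (<) \<alpha> \<and> set \<alpha> \<subseteq> {..<n}}"

definition consec_seqs :: "nat \<Rightarrow> nat \<Rightarrow> nat list set" where
  "consec_seqs k n = {\<alpha> \<in> incr_seqs k n. \<forall>i. Suc i < k \<longrightarrow> \<alpha> ! Suc i = Suc (\<alpha> ! i)}"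

definition submat :: "real mat \<Rightarrow> nat list \<Rightarrow> nat list \<Rightarrow> real mat" where
  "submat A \<alpha> \<beta> = submatrix A (set \<alpha>) (set \<beta>)"

lemma pick_set_incr_seqs:
  assumes "\<alpha> \<in> incr_seqs k n" and "i < k"
  shows "pick (set \<alpha>) i = \<alpha> ! i"
proof -
  have len: "length \<alpha> = k" and srt: "sorted_wrt (<) \<alpha>"
    using assms(1) by (auto simp: incr_seqs_def)
  have mono: "\<alpha> ! p < \<alpha> ! q \<longleftrightarrow> p < q" if "p < k" "q < k" for p q
    using sorted_wrt_nth_less[OF srt, of p q] sorted_wrt_nth_less[OF srt, of q p] that len
    by (cases p q rule: linorder_cases) auto
  have "{a \<in> set \<alpha>. a < \<alpha> ! i} = (!) \<alpha> ` {..<i}"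
  proof (intro equalityI subsetI)
    fix a assume "a \<in> {a \<in> set \<alpha>. a < \<alpha> ! i}"
    then obtain p where "p < k" "a = \<alpha> ! p" "\<alpha> ! p < \<alpha> ! i"
      using len by (auto simp: in_set_conv_nth)
    then show "a \<in> (!) \<alpha> ` {..<i}"
      using mono assms(2) by auto
  next
    fix a assume "a \<in> (!) \<alpha> ` {..<i}"
    then obtain p where "p < i" "a = \<alpha> ! p"
      by auto
    then show "a \<in> {a \<in> set \<alpha>. a < \<alpha> ! i}"
      using mono[of p i] assms(2) len by auto
  qed
  moreover have "inj_on ((!) \<alpha>) {..<i}"
  proof (rule inj_onI)
    fix p q assume "p \<in> {..<i}" "q \<in> {..<i}" "\<alpha> ! p = \<alpha> ! q"
    then show "p = q"
      using mono[of p q] mono[of q p] assms(2) by simp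
  qed
  ultimately have "card {a \<in> set \<alpha>. a < \<alpha> ! i} = i"
    by (simp add: card_image)
  then show ?thesis
    using pick_card_in_set[of "\<alpha> ! i" "set \<alpha>"] assms(2) len by simp
qed

lemma submat_eq:
  assumes "A \<in> carrier_mat m n" and "\<alpha> \<in> incr_seqs k m" and "\<beta> \<in> incr_seqs l n"
  shows "submat A \<alpha> \<beta> = mat k l (\<lambda>(i, j). A $$ (\<alpha> ! i, \<beta> ! j))"
proof -
  have card: "card {i. i < n' \<and> i \<in> set \<gamma>} = k'" if "\<gamma> \<in> incr_seqs k' n'" for \<gamma> k' n'
  proof -
    have "{i. i < n' \<and> i \<in> set \<gamma>} = set \<gamma>"
      using that by (auto simp: incr_seqs_def)
    moreover have "distinct \<gamma>" "length \<gamma> = k'"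
      using that by (auto simp: incr_seqs_def strict_sorted_iff)
    ultimately show ?thesis
      by (simp add: distinct_card)
  qed
  show ?thesis
    using assms card[OF assms(2)] card[OF assms(3)]
    by (intro eq_matI) (auto simp: submat_def submatrix_def pick_set_incr_seqs)
qed

definition type_I_staircase :: "real mat \<Rightarrow> bool" where
  "type_I_staircase A \<longleftrightarrow>
     (\<forall>i < min (dim_row A) (dim_col A). A $$ (i, i) \<noteq> 0) \<and>
     (\<forall>i < dim_row A. \<forall>j < dim_col A. i > j \<and> A $$ (i, j) = 0 \<longrightarrow>
        (\<forall>k < dim_row A. \<forall>l < dim_col A. k \<ge> i \<and> l \<le> j \<longrightarrow> A $$ (k, l) = 0)) \<and>
     (\<forall>i < dim_row A. \<forall>j < dim_col A. i < j \<and> A $$ (i, j) = 0 \<longrightarrow>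
        (\<forall>k < dim_row A. \<forall>l < dim_col A. k \<le> i \<and> l \<ge> j \<longrightarrow> A $$ (k, l) = 0))"

definition backward_identity :: "nat \<Rightarrow> real mat" where
  "backward_identity m = mat m m (\<lambda>(i, j). if i + j + 1 = m then 1 else 0)"

definition type_II_staircase :: "real mat \<Rightarrow> bool" where
  "type_II_staircase A \<longleftrightarrow> type_I_staircase (backward_identity (dim_row A) * A)"

definition nontrivial :: "real mat \<Rightarrow> nat list \<Rightarrow> nat list \<Rightarrow> bool" where
  "nontrivial A \<alpha> \<beta> \<longleftrightarrow> (\<forall>i < length \<alpha>. A $$ (\<alpha> ! i, \<beta> ! i) \<noteq> 0)"

definition is_signature :: "nat \<Rightarrow> (nat \<Rightarrow> real) \<Rightarrow> bool" where
  "is_signature r \<epsilon> \<longleftrightarrow> (\<forall>k \<in> {1..r}. \<epsilon> k \<in> {1, -1})"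

definition full_rank :: "real mat \<Rightarrow> bool" where
  "full_rank A \<longleftrightarrow> vec_space.rank (dim_row A) A = min (dim_row A) (dim_col A)"

definition ASSR :: "(nat \<Rightarrow> real) \<Rightarrow> real mat \<Rightarrow> bool" where
  "ASSR \<epsilon> A \<longleftrightarrow>
     full_rank A \<and>
     is_signature (min (dim_row A) (dim_col A)) \<epsilon> \<and>
     (type_I_staircase A \<or> type_II_staircase A) \<and>
     (\<forall>k \<in> {1..min (dim_row A) (dim_col A)}.
        \<forall>\<alpha> \<in> incr_seqs k (dim_row A). \<forall>\<beta> \<in> incr_seqs k (dim_col A).
          nontrivial A \<alpha> \<beta> \<longrightarrow> \<epsilon> k * det (submat A \<alpha> \<beta>) > 0)"

text \<open>Unlike in \<^const>\<open>ASSR\<close>, the sign condition is imposed on all minors, trivial or not.\<close>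

definition SR :: "(nat \<Rightarrow> real) \<Rightarrow> real mat \<Rightarrow> bool" where
  "SR \<epsilon> A \<longleftrightarrow>
     full_rank A \<and>
     is_signature (min (dim_row A) (dim_col A)) \<epsilon> \<and>
     (type_I_staircase A \<or> type_II_staircase A) \<and>
     (\<forall>k \<in> {1..min (dim_row A) (dim_col A)}.
        \<forall>\<alpha> \<in> incr_seqs k (dim_row A). \<forall>\<beta> \<in> incr_seqs k (dim_col A).
          \<epsilon> k * det (submat A \<alpha> \<beta>) \<ge> 0)"

definition TP :: "real mat \<Rightarrow> bool" where
  "TP A \<longleftrightarrow> SR (\<lambda>_. 1) A"

definition col_subvec :: "real mat \<Rightarrow> nat list \<Rightarrow> nat \<Rightarrow> real vec" where
  "col_subvec A \<alpha> j = vec (length \<alpha>) (\<lambda>i. A $$ (\<alpha> ! i, j))"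

definition col_boundary_submatrix :: "nat \<Rightarrow> real mat \<Rightarrow> nat list \<Rightarrow> nat list \<Rightarrow> bool" where
  "col_boundary_submatrix k A \<alpha> \<beta> \<longleftrightarrow>
     k \<ge> 1 \<and> \<alpha> \<in> consec_seqs k (dim_row A) \<and> \<beta> \<in> consec_seqs k (dim_col A) \<and>
     nontrivial A \<alpha> \<beta> \<and>
     (\<beta> ! 0 = 0 \<or> \<beta> ! 0 > 0 \<and> col_subvec A \<alpha> (\<beta> ! 0 - 1) = 0\<^sub>v k)"

definition col_gen_boundary_submatrix :: "nat \<Rightarrow> real mat \<Rightarrow> nat list \<Rightarrow> nat list \<Rightarrow> bool" where
  "col_gen_boundary_submatrix k M \<alpha> \<beta> \<longleftrightarrow>
     k \<ge> 1 \<and> \<alpha> \<in> consec_seqs k (dim_row M) \<and> \<beta> \<in> consec_seqs k (dim_col M) \<and>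
     M $$ (\<alpha> ! 0, \<beta> ! 0) \<noteq> 0 \<and>
     (\<beta> ! 0 = 0 \<or> \<beta> ! 0 > 0 \<and> col_subvec M \<alpha> (\<beta> ! 0 - 1) = 0\<^sub>v k)"

end

theory Submission
  imports Defs
begin

text \<open>
  In a type-I staircase matrix a trivial minor vanishes because of a large zero block, so all minors
  of \<open>A\<close> of one order have weakly the same sign, and by Cauchy--Binet \<open>A\<^sup>T A = R\<^sup>T R\<close> is totally
  nonnegative.  The initial rows of this Gram matrix give the sign of the minors of \<open>R\<close> with
  initial, hence with consecutive, rows.  For arbitrary rows, multiply \<open>R\<close> by a strictly totally
  positive kernel close to the identity: the product has strictly positive minors with consecutive
  rows, so Fekete's criterion makes all its minors positive, and \<open>R\<close> is a limit of such products.
  The claim on \<open>Q\<close> follows from \<open>A[\<alpha>|\<beta>] = Q[\<alpha>|\<beta>] R[\<beta>|\<beta>]\<close> for column boundary submatrices.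
\<close>

section \<open>Determinants of finite sections\<close>

text \<open>A function on all pairs of naturals stands in for a matrix, so that selecting, shifting
  and transposing indices become composition with index maps, free of dimension conditions.\<close>

definition fdet :: "nat \<Rightarrow> (nat \<Rightarrow> nat \<Rightarrow> 'a::comm_ring_1) \<Rightarrow> 'a" where
  "fdet k f = det (mat k k (\<lambda>(i, j). f i j))"

lemma fdet_Leibniz:
  "fdet k f = (\<Sum>p | p permutes {..<k}. signof p * (\<Prod>i<k. f i (p i)))"
proof -
  have "fdet k f = (\<Sum>p | p permutes {..<k}.
      signof p * (\<Prod>i<k. mat k k (\<lambda>(i, j). f i j) $$ (i, p i)))"
    unfolding fdet_def by (subst det_def'[of _ k]) (auto simp: lessThan_atLeast0)
  also have "\<dots> = (\<Sum>p | p permutes {..<k}. signof p * (\<Prod>i<k. f i (p i)))"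
  proof (intro sum.cong refl arg_cong2[where f="(*)"] prod.cong)
    fix p i assume "p \<in> {p. p permutes {..<k}}" "i \<in> {..<k}"
    then have "i < k" "p i < k"
      using permutes_in_image[of p "{..<k}" i] by auto
    then show "mat k k (\<lambda>(i, j). f i j) $$ (i, p i) = f i (p i)"
      by simp
  qed
  finally show ?thesis .
qed

lemma fdet_cong:
  assumes "\<And>i j. i < k \<Longrightarrow> j < k \<Longrightarrow> f i j = g i j"
  shows "fdet k f = fdet k g"
  unfolding fdet_def by (intro arg_cong[where f=det]) (auto simp: assms)

lemma fdet_0 [simp]: "fdet 0 f = 1"
  by (simp add: fdet_def)

lemma fdet_transpose: "fdet k (\<lambda>i j. f j i) = fdet k f"
proof -
  have "mat k k (\<lambda>(i, j). f j i) = transpose_mat (mat k k (\<lambda>(i, j). f i j))"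
    by (intro eq_matI) auto
  then show ?thesis
    by (simp add: fdet_def det_transpose[of _ k])
qed

text \<open>Multilinearity in the rows; \<open>c i\<close> records the summand chosen in row
  \<open>i\<close>. The sets \<open>S i\<close> may vary with the row: equal sets serve
  Cauchy-Binet, adjacent intervals serve Fekete's criterion.\<close>

lemma fdet_sum_rows:
  assumes "\<And>i. i < k \<Longrightarrow> finite (S i)"
  shows "fdet k (\<lambda>i j. \<Sum>l\<in>S i. x i l * g l j) =
    (\<Sum>c\<in>PiE {..<k} S. (\<Prod>i<k. x i (c i)) * fdet k (\<lambda>i. g (c i)))"
proof -
  have "fdet k (\<lambda>i j. \<Sum>l\<in>S i. x i l * g l j) = (\<Sum>p | p permutes {..<k}.
      signof p * (\<Sum>c\<in>PiE {..<k} S. \<Prod>i<k. x i (c i) * g (c i) (p i)))"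
    unfolding fdet_Leibniz
    by (intro sum.cong refl arg_cong2[where f="(*)"] prod_sum_PiE) (auto simp: assms)
  also have "\<dots> = (\<Sum>c\<in>PiE {..<k} S. \<Sum>p | p permutes {..<k}.
      signof p * (\<Prod>i<k. x i (c i) * g (c i) (p i)))"
    by (subst sum.swap) (simp add: sum_distrib_left)
  also have "\<dots> = (\<Sum>c\<in>PiE {..<k} S. (\<Prod>i<k. x i (c i)) * fdet k (\<lambda>i. g (c i)))"
    unfolding fdet_Leibniz sum_distrib_left by (simp add: prod.distrib mult_ac)
  finally show ?thesis .
qed

lemma fdet_scale_rows: "fdet k (\<lambda>i j. r i * f i j) = (\<Prod>i<k. r i) * fdet k f"
  unfolding fdet_Leibniz sum_distrib_left by (simp add: prod.distrib mult_ac)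

lemma fdet_scale_cols: "fdet k (\<lambda>i j. r j * f i j) = (\<Prod>j<k. r j) * fdet k f"
  using fdet_scale_rows[of k r "\<lambda>i j. f j i"] fdet_transpose[of k f]
    fdet_transpose[of k "\<lambda>i j. r j * f i j"] by argo

lemma fdet_permute_rows:
  assumes "p permutes {..<k}"
  shows "fdet k (\<lambda>i. f (p i)) = signof p * fdet k f"
proof -
  have "mat k k (\<lambda>(i, j). f (p i) j) = mat k k (\<lambda>(i, j). mat k k (\<lambda>(i, j). f i j) $$ (p i, j))"
    using assms permutes_in_image[of p "{..<k}"] by (intro eq_matI) auto
  then show ?thesis
    unfolding fdet_def using det_permute_rows[of "mat k k (\<lambda>(i, j). f i j)" k p] assms
    by (simp add: lessThan_atLeast0)
qed

lemma fdet_identical_rows: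
  assumes "i < k" "i' < k" "i \<noteq> i'" "f i = f i'"
  shows "fdet k f = 0"
  unfolding fdet_def
  by (rule det_identical_rows[of _ k i i']) (use assms in \<open>auto simp: row_def\<close>)

lemma fdet_mult: "fdet k (\<lambda>i j. \<Sum>l<k. x i l * y l j) = fdet k x * fdet k y"
proof -
  have "mat k k (\<lambda>(i, j). \<Sum>l<k. x i l * y l j) =
      mat k k (\<lambda>(i, j). x i j) * mat k k (\<lambda>(i, j). y i j)"
    by (intro eq_matI) (auto simp: scalar_prod_def lessThan_atLeast0)
  then show ?thesis
    unfolding fdet_def by (simp add: det_mult[of _ k])
qed

lemma fdet_block:
  fixes f :: "nat \<Rightarrow> nat \<Rightarrow> 'a::idom"
  assumes "\<And>i j. i < s \<Longrightarrow> j < p \<Longrightarrow> f (p + i) j = 0"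
  shows "fdet (p + s) f = fdet p f * fdet s (\<lambda>i j. f (p + i) (p + j))"
proof -
  have "f i j = 0" if "\<not> i < p" "i < p + s" "j < p" for i j
    using assms[of "i - p" j] that by simp
  then have "mat (p + s) (p + s) (\<lambda>(i, j). f i j) = four_block_mat (mat p p (\<lambda>(i, j). f i j))
      (mat p s (\<lambda>(i, j). f i (p + j))) (0\<^sub>m s p) (mat s s (\<lambda>(i, j). f (p + i) (p + j)))"
    by (intro eq_matI) (auto simp: four_block_mat_def Let_def)
  then show ?thesis
    unfolding fdet_def by (simp add: det_four_block_mat_lower_left_zero[of _ p _ s])
qed

lemma fdet_1: "fdet (Suc 0) f = f 0 0"
  unfolding fdet_def by (subst det_single) auto

lemma fdet_upper_triangular:
  fixes f :: "nat \<Rightarrow> nat \<Rightarrow> 'a::idom"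
  assumes "\<And>i j. i < k \<Longrightarrow> j < i \<Longrightarrow> f i j = 0"
  shows "fdet k f = (\<Prod>i<k. f i i)"
  using assms
proof (induction k)
  case (Suc k)
  have "fdet (k + 1) f = fdet k f * fdet 1 (\<lambda>i j. f (k + i) (k + j))"
    by (rule fdet_block) (use Suc.prems in auto)
  moreover have "fdet 1 (\<lambda>i j. f (k + i) (k + j)) = f k k"
    by (simp add: fdet_1)
  ultimately show ?case
    using Suc by simp
qed simp

lemma fdet_2: "fdet 2 f = f 0 0 * f 1 1 - f 0 1 * f 1 0"
proof -
  let ?M = "mat 2 2 (\<lambda>(i, j). f i j)"
  have minors: "det (mat_delete ?M 0 0) = f 1 1" "det (mat_delete ?M (Suc 0) 0) = f 0 1"
    by (subst det_single; simp add: mat_delete_def)+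
  have "{..<2} = {0, 1 :: nat}"
    by auto
  then show ?thesis
    unfolding fdet_def using laplace_expansion_column[of ?M 2 0]
    by (simp add: cofactor_def minors mult.commute)
qed

text \<open>The zero block has \<open>k - s\<close> rows and \<open>s + 1\<close> columns, together
  more than \<open>k\<close>, so by the pigeonhole principle every term of the Leibniz expansion
  meets it.\<close>

lemma fdet_zero_block:
  assumes "s < k" "\<And>i j. s \<le> i \<Longrightarrow> i < k \<Longrightarrow> j \<le> s \<Longrightarrow> f i j = 0"
  shows "fdet k f = 0"
proof -
  have "(\<Prod>i<k. f i (p i)) = 0" if p: "p permutes {..<k}" for p
  proof -
    have "\<exists>i. s \<le> i \<and> i < k \<and> p i \<le> s"
    proof (rule ccontr)
      assume "\<not> ?thesis"
      then have "p ` {s..<k} \<subseteq> {s<..<k}"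
        using permutes_in_image[OF p] by auto
      moreover have "inj_on p {s..<k}"
        using permutes_inj_on[OF p] .
      ultimately have "card {s..<k} \<le> card {s<..<k}"
        by (intro card_inj_on_le) auto
      then show False
        using assms(1) by simp
    qed
    then obtain i where "s \<le> i" "i < k" "p i \<le> s"
      by auto
    then show ?thesis
      using assms(2)[of i "p i"] by (intro prod_zero) auto
  qed
  then show ?thesis
    unfolding fdet_Leibniz by simp
qed

text \<open>With a first column of ones, the matrix is the all-ones lower triangular matrix times the
  matrix of successive row differences.\<close>

lemma fdet_ones_column:
  fixes f :: "nat \<Rightarrow> nat \<Rightarrow> 'a::idom"
  assumes "\<And>i. i \<le> k \<Longrightarrow> f i 0 = 1"
  shows "fdet (Suc k) f = fdet k (\<lambda>i j. f (Suc i) (Suc j) - f i (Suc j))"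
proof -
  define e where "e i j = (if i = 0 then f 0 j else f i j - f (i - 1) j)" for i j
  define l :: "nat \<Rightarrow> nat \<Rightarrow> 'a" where "l i j = (if j \<le> i then 1 else 0)" for i j
  have tele: "(\<Sum>q\<le>i. e q j) = f i j" for i j
    by (induction i) (auto simp: e_def)
  have "fdet (Suc k) f = fdet (Suc k) (\<lambda>i j. \<Sum>q<Suc k. l i q * e q j)"
  proof (rule fdet_cong)
    fix i j assume "i < Suc k" "j < Suc k"
    have "(\<Sum>q<Suc k. l i q * e q j) = (\<Sum>q\<le>i. e q j)"
      using \<open>i < Suc k\<close> by (intro sum.mono_neutral_cong_right) (auto simp: l_def)
    then show "f i j = (\<Sum>q<Suc k. l i q * e q j)"
      by (simp add: tele)
  qed
  also have "\<dots> = fdet (Suc k) l * fdet (Suc k) e"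
    by (rule fdet_mult)
  also have "fdet (Suc k) l = fdet (Suc k) (\<lambda>i j. l j i)"
    by (rule fdet_transpose[symmetric])
  also have "\<dots> = 1"
    by (subst fdet_upper_triangular) (auto simp: l_def)
  also have "fdet (Suc k) e = fdet 1 e * fdet k (\<lambda>i j. e (1 + i) (1 + j))"
    using fdet_block[of k 1 e] assms by (simp add: e_def)
  also have "fdet 1 e = 1"
    using assms[of 0] by (simp add: fdet_1 e_def)
  finally show ?thesis
    by (simp add: e_def)
qed

section \<open>Increasing index sequences and the Cauchy-Binet formula\<close>

lemma incr_seqs_nth_less:
  "\<gamma> \<in> incr_seqs k n \<Longrightarrow> i < j \<Longrightarrow> j < k \<Longrightarrow> \<gamma> ! i < \<gamma> ! j"
  unfolding incr_seqs_def by (auto intro: sorted_wrt_nth_less)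

lemma incr_seqs_nth_bound: "\<gamma> \<in> incr_seqs k n \<Longrightarrow> i < k \<Longrightarrow> \<gamma> ! i < n"
  unfolding incr_seqs_def by (auto simp: subset_iff)

lemma finite_incr_seqs: "finite (incr_seqs k n)"
  by (rule finite_subset[OF _ finite_lists_length_eq[of "{..<n}" k]]) (auto simp: incr_seqs_def)

lemma incr_seqs_bij_betw:
  assumes "\<gamma> \<in> incr_seqs k n"
  shows "bij_betw ((!) \<gamma>) {..<k} (set \<gamma>)"
  using assms by (intro bij_betw_nth) (auto simp: incr_seqs_def strict_sorted_iff)

text \<open>An injective choice of indices factors uniquely as a permutation followed by the
  increasing enumeration of its range. Cauchy-Binet groups its terms by that range.\<close>

lemma bij_betw_incr_seqs_permutes:
  "bij_betw (\<lambda>(\<gamma>, p). restrict (\<lambda>i. \<gamma> ! p i) {..<k})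
     (incr_seqs k n \<times> {p. p permutes {..<k}})
     {c \<in> {..<k} \<rightarrow>\<^sub>E {..<n}. inj_on c {..<k}}" (is "bij_betw ?h ?X ?Y")
proof (rule bij_betw_imageI)
  have image: "?h (\<gamma>, p) ` {..<k} = set \<gamma>" if "\<gamma> \<in> incr_seqs k n" "p permutes {..<k}" for \<gamma> p
  proof -
    have "?h (\<gamma>, p) ` {..<k} = (!) \<gamma> ` p ` {..<k}"
      by auto
    then show ?thesis
      using permutes_image[OF that(2)] bij_betw_imp_surj_on[OF incr_seqs_bij_betw[OF that(1)]]
      by simp
  qed
  show "inj_on ?h ?X"
  proof (intro inj_onI, clarify)
    fix \<gamma> p \<gamma>' p'
    assume *: "\<gamma> \<in> incr_seqs k n" "p permutes {..<k}" "\<gamma>' \<in> incr_seqs k n" "p' permutes {..<k}"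
      and eq: "restrict (\<lambda>i. \<gamma> ! p i) {..<k} = restrict (\<lambda>i. \<gamma>' ! p' i) {..<k}"
    have "set \<gamma> = set \<gamma>'"
      using image[OF *(1,2)] image[OF *(3,4)] eq by simp
    then have "\<gamma> = \<gamma>'"
      using *(1,3) by (auto simp: incr_seqs_def intro: strict_sorted_equal)
    moreover have "p i = p' i" for i
    proof (cases "i < k")
      case True
      then have "\<gamma> ! p i = \<gamma> ! p' i"
        using fun_cong[OF eq, of i] \<open>\<gamma> = \<gamma>'\<close> by simp
      moreover have "p i < k" "p' i < k"
        using True permutes_in_image[OF *(2)] permutes_in_image[OF *(4)] by auto
      ultimately show ?thesis
        using bij_betw_imp_inj_on[OF incr_seqs_bij_betw[OF *(1)]] by (auto simp: inj_on_def)
    next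
      case False
      then show ?thesis
        using permutes_not_in[OF *(2)] permutes_not_in[OF *(4)] by simp
    qed
    ultimately show "\<gamma> = \<gamma>' \<and> p = p'"
      by auto
  qed
  show "?h ` ?X = ?Y"
  proof (intro equalityI subsetI)
    fix c assume "c \<in> ?h ` ?X"
    then obtain \<gamma> p where *: "\<gamma> \<in> incr_seqs k n" "p permutes {..<k}" "c = ?h (\<gamma>, p)"
      by auto
    have "inj_on ((!) \<gamma> \<circ> p) {..<k}"
      using permutes_image[OF *(2)] permutes_inj_on[OF *(2)]
        bij_betw_imp_inj_on[OF incr_seqs_bij_betw[OF *(1)]]
      by (intro comp_inj_on) auto
    moreover have "p i < k" if "i < k" for i
      using that permutes_in_image[OF *(2)] by auto
    ultimately show "c \<in> ?Y"
      using incr_seqs_nth_bound[OF *(1)] by (auto simp: *(3) inj_on_def)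
  next
    fix c assume "c \<in> ?Y"
    then have c: "c \<in> {..<k} \<rightarrow>\<^sub>E {..<n}" "inj_on c {..<k}"
      by auto
    define \<gamma> where "\<gamma> = sorted_list_of_set (c ` {..<k})"
    have \<gamma>: "\<gamma> \<in> incr_seqs k n" "set \<gamma> = c ` {..<k}"
      using c by (auto simp: \<gamma>_def incr_seqs_def card_image)
    \<comment> \<open>Position of \<open>c i\<close> in the sorted range, extended by the identity
      as \<open>permutes\<close> demands.\<close>
    define p where "p i = (if i < k then the_inv_into {..<k} ((!) \<gamma>) (c i) else i)" for i
    have bij: "bij_betw (the_inv_into {..<k} ((!) \<gamma>)) (c ` {..<k}) {..<k}"
      using bij_betw_the_inv_into[OF incr_seqs_bij_betw[OF \<gamma>(1)]] by (simp add: \<gamma>(2))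
    have "bij_betw (the_inv_into {..<k} ((!) \<gamma>) \<circ> c) {..<k} {..<k}"
      using bij_betw_trans[OF inj_on_imp_bij_betw[OF c(2)] bij] .
    then have "bij_betw p {..<k} {..<k}"
      by (rule bij_betw_cong[THEN iffD1, rotated]) (auto simp: p_def)
    then have "p permutes {..<k}"
      by (rule bij_imp_permutes) (auto simp: p_def)
    moreover have "\<gamma> ! p i = c i" if "i < k" for i
      using that f_the_inv_into_f_bij_betw[OF incr_seqs_bij_betw[OF \<gamma>(1)], of "c i"]
      by (auto simp: p_def \<gamma>(2))
    then have "c = ?h (\<gamma>, p)"
      using c(1) by (auto simp: fun_eq_iff PiE_def extensional_def)
    ultimately show "c \<in> ?h ` ?X"
      using \<gamma>(1) by blast
  qed
qed

lemma fdet_Cauchy_Binet: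
  "fdet k (\<lambda>i j. \<Sum>l<n. x i l * y l j) =
    (\<Sum>\<gamma>\<in>incr_seqs k n. fdet k (\<lambda>i j. x i (\<gamma> ! j)) * fdet k (\<lambda>i. y (\<gamma> ! i)))"
proof -
  let ?F = "{..<k} \<rightarrow>\<^sub>E {..<n}"
  let ?I = "{c \<in> ?F. inj_on c {..<k}}"
  let ?h = "\<lambda>(\<gamma>, p). restrict (\<lambda>i. \<gamma> ! p i) {..<k}"
  have "fdet k (\<lambda>i j. \<Sum>l<n. x i l * y l j) =
      (\<Sum>c\<in>?F. (\<Prod>i<k. x i (c i)) * fdet k (\<lambda>i. y (c i)))"
    by (rule fdet_sum_rows) auto
  \<comment> \<open>A choice that is not injective repeats a row of \<open>y\<close> and contributes
    zero.\<close>
  also have "\<dots> = (\<Sum>c\<in>?I. (\<Prod>i<k. x i (c i)) * fdet k (\<lambda>i. y (c i)))"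
  proof (rule sum.mono_neutral_right)
    show "\<forall>c\<in>?F - ?I. (\<Prod>i<k. x i (c i)) * fdet k (\<lambda>i. y (c i)) = 0"
    proof
      fix c assume "c \<in> ?F - ?I"
      then obtain i i' where "i < k" "i' < k" "i \<noteq> i'" "c i = c i'"
        by (auto simp: inj_on_def)
      then show "(\<Prod>i<k. x i (c i)) * fdet k (\<lambda>i. y (c i)) = 0"
        using fdet_identical_rows[of i k i' "\<lambda>i. y (c i)"] by simp
    qed
  qed (auto intro: finite_PiE)
  also have "\<dots> = (\<Sum>(\<gamma>, p)\<in>incr_seqs k n \<times> {p. p permutes {..<k}}.
      (\<Prod>i<k. x i (\<gamma> ! p i)) * fdet k (\<lambda>i. y (\<gamma> ! p i)))"
    by (subst sum.reindex_bij_betw[OF bij_betw_incr_seqs_permutes, symmetric])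
      (intro sum.cong refl, clarify, intro arg_cong2[where f="(*)"] prod.cong refl fdet_cong, simp_all)
  also have "\<dots> = (\<Sum>\<gamma>\<in>incr_seqs k n. \<Sum>p | p permutes {..<k}.
      (\<Prod>i<k. x i (\<gamma> ! p i)) * fdet k (\<lambda>i. y (\<gamma> ! p i)))"
    by (subst sum.cartesian_product) simp
  also have "\<dots> = (\<Sum>\<gamma>\<in>incr_seqs k n. \<Sum>p | p permutes {..<k}.
      signof p * (\<Prod>i<k. x i (\<gamma> ! p i)) * fdet k (\<lambda>i. y (\<gamma> ! i)))"
    by (intro sum.cong refl) (simp add: fdet_permute_rows[where f="\<lambda>i. y (\<gamma> ! i)" for \<gamma>])
  also have "\<dots> = (\<Sum>\<gamma>\<in>incr_seqs k n. fdet k (\<lambda>i j. x i (\<gamma> ! j)) * fdet k (\<lambda>i. y (\<gamma> ! i)))"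
    unfolding fdet_Leibniz[of k "\<lambda>i j. x i (\<gamma> ! j)" for \<gamma>] sum_distrib_right ..
  finally show ?thesis .
qed

section \<open>Fekete's criterion and its limit form\<close>

lemma tendsto_fdet:
  fixes f :: "'b \<Rightarrow> nat \<Rightarrow> nat \<Rightarrow> real"
  assumes "\<And>i j. i < k \<Longrightarrow> j < k \<Longrightarrow> ((\<lambda>x. f x i j) \<longlongrightarrow> g i j) F"
  shows "((\<lambda>x. fdet k (f x)) \<longlongrightarrow> fdet k g) F"
  unfolding fdet_Leibniz
proof (intro tendsto_sum tendsto_mult tendsto_const tendsto_prod)
  fix p i assume "p \<in> {p. p permutes {..<k}}" "i \<in> {..<k}"
  then show "((\<lambda>x. f x i (p i)) \<longlongrightarrow> g i (p i)) F"
    using permutes_in_image[of p "{..<k}" i] by (intro assms) auto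
qed

text \<open>Common induction step of Fekete's criterion and of the power kernel. Each difference of
  rows \<open>a i\<close> and \<open>a (Suc i)\<close> telescopes into unit differences, and
  multilinearity turns the minor into a nonempty sum over choices \<open>c\<close> of one unit
  difference per interval.\<close>

lemma fdet_pos_of_row_differences:
  fixes f :: "nat \<Rightarrow> nat \<Rightarrow> real"
  assumes "\<And>i. i \<le> k \<Longrightarrow> f (a i) 0 = 1"
    and "\<And>i. i < k \<Longrightarrow> a i < a (Suc i)"
    and pos: "\<And>c. (\<And>i. i < k \<Longrightarrow> a i \<le> c i \<and> c i < a (Suc i)) \<Longrightarrow>
      fdet k (\<lambda>i j. f (Suc (c i)) (Suc j) - f (c i) (Suc j)) > 0"
  shows "fdet (Suc k) (\<lambda>i. f (a i)) > 0"
proof -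
  define d where "d = (\<lambda>l j. f (Suc l) (Suc j) - f l (Suc j))"
  define S where "S i = {a i..<a (Suc i)}" for i
  have "fdet (Suc k) (\<lambda>i. f (a i)) = fdet k (\<lambda>i j. f (a (Suc i)) (Suc j) - f (a i) (Suc j))"
    by (rule fdet_ones_column) (rule assms(1))
  also have "\<dots> = fdet k (\<lambda>i j. \<Sum>l\<in>S i. 1 * d l j)"
  proof (rule fdet_cong)
    fix i j assume "i < k"
    then show "f (a (Suc i)) (Suc j) - f (a i) (Suc j) = (\<Sum>l\<in>S i. 1 * d l j)"
      using sum_Suc_diff'[of "a i" "a (Suc i)" "\<lambda>l. f l (Suc j)"] assms(2)[of i]
      by (simp add: S_def d_def)
  qed
  also have "\<dots> = (\<Sum>c\<in>PiE {..<k} S. (\<Prod>i<k. 1) * fdet k (\<lambda>i. d (c i)))"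
    by (rule fdet_sum_rows) (simp add: S_def)
  also have "\<dots> > 0"
  proof (rule sum_pos)
    show "finite (PiE {..<k} S)"
      by (intro finite_PiE) (auto simp: S_def)
    show "PiE {..<k} S \<noteq> {}"
      using assms(2) by (auto simp: PiE_eq_empty_iff S_def)
    fix c assume "c \<in> PiE {..<k} S"
    then have c: "a i \<le> c i \<and> c i < a (Suc i)" if "i < k" for i
      using that by (auto simp: S_def PiE_iff)
    show "(\<Prod>i<k. 1) * fdet k (\<lambda>i. d (c i)) > 0"
      using pos[OF c] by (simp add: d_def)
  qed
  finally show ?thesis .
qed

text \<open>Fekete's criterion.  Once the first column is normalised to ones, a minor with arbitrary rows
  is a sum of minors, of one order less, of the matrix of successive row differences; and the
  consecutive-row minors of the latter are consecutive-row minors of the former.\<close>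

lemma fdet_pos_of_consecutive_rows:
  fixes f :: "nat \<Rightarrow> nat \<Rightarrow> real"
  assumes "\<And>s p. 1 \<le> s \<Longrightarrow> s \<le> k \<Longrightarrow> p + s \<le> n \<Longrightarrow> fdet s (\<lambda>i. f (p + i)) > 0"
    and "\<And>i j. i < j \<Longrightarrow> j < k \<Longrightarrow> a i < a j"
    and "\<And>i. i < k \<Longrightarrow> a i < n"
  shows "fdet k (\<lambda>i. f (a i)) > 0"
  using assms
proof (induction k arbitrary: f a n)
  case 0
  show ?case
    by simp
next
  case (Suc k)
  have f0: "f i 0 > 0" if "i < n" for i
  proof -
    have "fdet 1 (\<lambda>l. f (i + l)) = f i 0"
      by (simp add: fdet_1)
    then show ?thesis
      using Suc.prems(1)[of 1 i] that by simp
  qed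
  define g where "g i j = f i j / f i 0" for i j
  define d where "d = (\<lambda>i j. g (Suc i) (Suc j) - g i (Suc j))"
  have scale: "fdet s (\<lambda>i. f (b i)) = (\<Prod>i<s. f (b i) 0) * fdet s (\<lambda>i. g (b i))"
    if "\<And>i. i < s \<Longrightarrow> b i < n" for s b
  proof -
    have "fdet s (\<lambda>i. f (b i)) = fdet s (\<lambda>i j. f (b i) 0 * g (b i) j)"
    proof (rule fdet_cong)
      fix i j assume "i < s"
      then show "f (b i) j = f (b i) 0 * g (b i) j"
        using f0[OF that, of i] by (simp add: g_def)
    qed
    then show ?thesis
      by (simp add: fdet_scale_rows)
  qed
  have prod_pos: "(\<Prod>i<s. f (b i) 0) > 0" if "\<And>i. i < s \<Longrightarrow> b i < n" for s b
    using that f0 by (intro prod_pos) auto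
  \<comment> \<open>A block of \<open>s\<close> rows of \<open>d\<close> uses \<open>s + 1\<close>
    rows of \<open>f\<close>, so one row and one order are lost: hence the bounds
    \<open>n - 1\<close> and \<open>k\<close>.\<close>
  have d_pos: "fdet s (\<lambda>i. d (p + i)) > 0" if "1 \<le> s" "s \<le> k" "p + s \<le> n - 1" for s p
  proof -
    have lt: "p + i < n" if "i < Suc s" for i
      using that \<open>1 \<le> s\<close> \<open>p + s \<le> n - 1\<close> by simp
    have "fdet (Suc s) (\<lambda>i. f (p + i)) > 0"
      using Suc.prems(1)[of "Suc s" p] that by simp
    also have "fdet (Suc s) (\<lambda>i. f (p + i)) =
        (\<Prod>i<Suc s. f (p + i) 0) * fdet (Suc s) (\<lambda>i. g (p + i))"
      by (rule scale) (rule lt)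
    finally have "fdet (Suc s) (\<lambda>i. g (p + i)) > 0"
      by (rule zero_less_mult_pos) (rule prod_pos, rule lt)
    also have "fdet (Suc s) (\<lambda>i. g (p + i)) =
        fdet s (\<lambda>i j. g (p + Suc i) (Suc j) - g (p + i) (Suc j))"
    proof (rule fdet_ones_column)
      fix i assume "i \<le> s"
      then show "g (p + i) 0 = 1"
        using f0[OF lt, of i] by (simp add: g_def)
    qed
    finally show ?thesis
      by (simp add: d_def)
  qed
  have "fdet (Suc k) (\<lambda>i. g (a i)) > 0"
  proof (rule fdet_pos_of_row_differences)
    fix i assume "i \<le> k"
    then show "g (a i) 0 = 1"
      using f0[OF Suc.prems(3)[of i]] by (simp add: g_def)
  next
    fix i assume "i < k"
    then show "a i < a (Suc i)"
      by (intro Suc.prems(2)) auto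
  next
    fix c assume c: "\<And>i. i < k \<Longrightarrow> a i \<le> c i \<and> c i < a (Suc i)"
    have "fdet k (\<lambda>i. d (c i)) > 0"
    proof (rule Suc.IH)
      fix i j assume "i < j" "j < k"
      \<comment> \<open>The half-open intervals between successive \<open>a i\<close> are disjoint
        and ordered, so the chosen rows increase strictly.\<close>
      then have "c i < a (Suc i)" "a (Suc i) \<le> a j" "a j \<le> c j"
        using c[of i] c[of j] Suc.prems(2)[of "Suc i" j] by (cases "Suc i = j"; simp)+
      then show "c i < c j"
        by simp
    next
      fix i assume "i < k"
      then show "c i < n - 1"
        using c[of i] Suc.prems(3)[of "Suc i"] by linarith
    qed (rule d_pos)
    then show "fdet k (\<lambda>i j. g (Suc (c i)) (Suc j) - g (c i) (Suc j)) > 0"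
      by (simp add: d_def)
  qed
  then show ?case
    using scale[of "Suc k" a] prod_pos[of "Suc k" a] Suc.prems(3) by simp
qed

section \<open>Strict total positivity of the Gaussian kernel\<close>

text \<open>A generalised Vandermonde determinant. After the first column is normalised to ones, the
  unit row differences are \<open>(x ^ e j - 1) * x ^ (c i * e j)\<close>: again a power kernel, up
  to positive column factors, so induction applies.\<close>

lemma fdet_power_pos:
  fixes x :: real
  assumes "x > 1"
    and "\<And>i j. i < j \<Longrightarrow> j < k \<Longrightarrow> a i < a j"
    and "\<And>i j. i < j \<Longrightarrow> j < k \<Longrightarrow> b i < b j"
  shows "fdet k (\<lambda>i j. x ^ (a i * b j)) > 0"
  using assms(2,3)
proof (induction k arbitrary: a b)
  case 0
  show ?case
    by simp
next
  case (Suc k)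
  define g where "g i j = x ^ (i * (b j - b 0))" for i j
  define e where "e j = b (Suc j) - b 0" for j
  have "fdet (Suc k) (\<lambda>i. g (a i)) > 0"
  proof (rule fdet_pos_of_row_differences)
    fix i assume "i < k"
    then show "a i < a (Suc i)"
      by (intro Suc.prems(1)) auto
  next
    fix c assume c: "\<And>i. i < k \<Longrightarrow> a i \<le> c i \<and> c i < a (Suc i)"
    have "fdet k (\<lambda>i j. x ^ (c i * e j)) > 0"
    proof (rule Suc.IH)
      fix i j assume "i < j" "j < k"
      then have "c i < a (Suc i)" "a (Suc i) \<le> a j" "a j \<le> c j"
        using c[of i] c[of j] Suc.prems(1)[of "Suc i" j] by (cases "Suc i = j"; simp)+
      then show "c i < c j"
        by simp
      have "b 0 < b (Suc i)" "b (Suc i) < b (Suc j)"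
        using Suc.prems(2)[of 0 "Suc i"] Suc.prems(2)[of "Suc i" "Suc j"] \<open>i < j\<close> \<open>j < k\<close> by auto
      then show "e i < e j"
        by (simp add: e_def)
    qed
    moreover have "(\<Prod>j<k. x ^ e j - 1) > 0"
    proof (rule prod_pos)
      fix j assume "j \<in> {..<k}"
      then show "x ^ e j - 1 > 0"
        using Suc.prems(2)[of 0 "Suc j"] \<open>x > 1\<close> by (simp add: e_def)
    qed
    ultimately have "fdet k (\<lambda>i j. (x ^ e j - 1) * x ^ (c i * e j)) > 0"
      by (simp add: fdet_scale_cols[where f="\<lambda>i j. x ^ (c i * e j)"])
    also have "(\<lambda>i j. (x ^ e j - 1) * x ^ (c i * e j)) =
        (\<lambda>i j. g (Suc (c i)) (Suc j) - g (c i) (Suc j))"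
      by (simp add: g_def e_def left_diff_distrib power_add)
    finally show "fdet k (\<lambda>i j. g (Suc (c i)) (Suc j) - g (c i) (Suc j)) > 0" .
  qed (simp add: g_def)
  moreover have "fdet (Suc k) (\<lambda>i j. x ^ (a i * b j)) =
      fdet (Suc k) (\<lambda>i j. x ^ (a i * b 0) * g (a i) j)"
  proof (rule fdet_cong)
    fix i j assume "j < Suc k"
    then have "b 0 \<le> b j"
      using Suc.prems(2)[of 0 j] by (cases "j = 0") auto
    then have "a i * b j = a i * b 0 + a i * (b j - b 0)"
      by (simp flip: add_mult_distrib2)
    then show "x ^ (a i * b j) = x ^ (a i * b 0) * g (a i) j"
      by (simp add: g_def power_add)
  qed
  moreover have "(\<Prod>i<Suc k. x ^ (a i * b 0)) > 0"
    using \<open>x > 1\<close> by (intro prod_pos) auto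
  ultimately show ?case
    by (simp only: fdet_scale_rows zero_less_mult_iff) simp
qed

text \<open>The Gaussian kernel \<open>q ^ (i - j)\<^sup>2\<close> with \<open>q = 1 / x\<close>, written so that the exponents are
  natural numbers.\<close>

definition gauss_kernel :: "real \<Rightarrow> nat \<Rightarrow> nat \<Rightarrow> real" where
  "gauss_kernel x i j = x ^ (2 * i * j) / (x ^ i\<^sup>2 * x ^ j\<^sup>2)"

text \<open>The kernel is the power kernel with exponents \<open>a i * (2 * b j)\<close>, rescaled
  by positive row and column factors.\<close>

lemma fdet_gauss_kernel_pos:
  assumes "x > 1"
    and "\<And>i j. i < j \<Longrightarrow> j < k \<Longrightarrow> a i < a j"
    and "\<And>i j. i < j \<Longrightarrow> j < k \<Longrightarrow> b i < b j"
  shows "fdet k (\<lambda>i j. gauss_kernel x (a i) (b j)) > 0"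
proof -
  have "(\<lambda>i j. gauss_kernel x (a i) (b j)) =
      (\<lambda>i j. 1 / x ^ (a i)\<^sup>2 * (1 / x ^ (b j)\<^sup>2 * x ^ (a i * (2 * b j))))"
    by (simp add: gauss_kernel_def fun_eq_iff mult_ac)
  then have "fdet k (\<lambda>i j. gauss_kernel x (a i) (b j)) =
      (\<Prod>i<k. 1 / x ^ (a i)\<^sup>2) * ((\<Prod>j<k. 1 / x ^ (b j)\<^sup>2) * fdet k (\<lambda>i j. x ^ (a i * (2 * b j))))"
    by (simp only: fdet_scale_rows[where r="\<lambda>i. 1 / x ^ (a i)\<^sup>2"]
        fdet_scale_cols[where r="\<lambda>j. 1 / x ^ (b j)\<^sup>2"])
  also have "\<dots> > 0"
    using assms by (intro mult_pos_pos prod_pos fdet_power_pos) auto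
  finally show ?thesis .
qed

lemma tendsto_gauss_kernel:
  "((\<lambda>x. gauss_kernel x i j) \<longlongrightarrow> (if i = j then 1 else 0)) at_top"
proof (cases "i = j")
  case True
  have "\<forall>\<^sub>F x :: real in at_top. gauss_kernel x i j = 1"
    using eventually_gt_at_top[of 0]
    by eventually_elim (simp add: gauss_kernel_def True power2_eq_square mult.assoc flip: power_add mult_2)
  then show ?thesis
    using True by (simp add: tendsto_eventually)
next
  case False
  \<comment> \<open>Subtraction of naturals truncates, so at least one summand is zero and
    \<open>d\<close> is the square of the distance between \<open>i\<close> and
    \<open>j\<close>.\<close>
  define d where "d = (i - j)\<^sup>2 + (j - i)\<^sup>2"
  have d: "i\<^sup>2 + j\<^sup>2 = 2 * i * j + d"
  proof (cases "i \<le> j")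
    case True
    then obtain q where "j = i + q"
      using le_iff_add by blast
    then show ?thesis
      by (simp add: d_def power2_eq_square algebra_simps)
  next
    case False
    then obtain q where "i = j + q"
      using le_iff_add[of j i] by auto
    then show ?thesis
      by (simp add: d_def power2_eq_square algebra_simps)
  qed
  have "d > 0"
    using False by (cases "i < j") (auto simp: d_def)
  then have "((\<lambda>x::real. inverse (x ^ d)) \<longlongrightarrow> 0) at_top"
    by (intro tendsto_inverse_0_at_top filterlim_pow_at_top filterlim_ident)
  moreover have "\<forall>\<^sub>F x in at_top. inverse (x ^ d) = gauss_kernel x i j"
    using eventually_gt_at_top[of 0]
    by eventually_elim (simp add: gauss_kernel_def d power_add divide_simps flip: power_add)
  ultimately show ?thesis
    using False by (simp add: tendsto_cong)
qed

text \<open>Fekete's criterion needs strict positivity, so \<open>r\<close> is first multiplied by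
  the Gaussian kernel. Letting \<open>x\<close> tend to infinity recovers \<open>r\<close>, with the
  strict inequality weakened in the limit.\<close>

lemma fdet_nonneg_of_consecutive_rows:
  fixes r :: "nat \<Rightarrow> nat \<Rightarrow> real"
  assumes nonneg: "\<And>s p \<gamma>. p + s \<le> n \<Longrightarrow> \<gamma> \<in> incr_seqs s n \<Longrightarrow>
      fdet s (\<lambda>i j. r (p + i) (\<gamma> ! j)) \<ge> 0"
    and pos: "\<And>s p. p + s \<le> n \<Longrightarrow> fdet s (\<lambda>i j. r (p + i) (p + j)) > 0"
    and \<alpha>: "\<alpha> \<in> incr_seqs k n" and \<beta>: "\<beta> \<in> incr_seqs k n"
  shows "fdet k (\<lambda>i j. r (\<alpha> ! i) (\<beta> ! j)) \<ge> 0"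
proof -
  define M where "M x i j = (\<Sum>l<n. r i l * gauss_kernel x l j)" for x i j
  have M_pos: "fdet k (\<lambda>i j. M x (\<alpha> ! i) (\<beta> ! j)) > 0" if "x > 1" for x
  proof (rule fdet_pos_of_consecutive_rows)
    fix s p :: nat
    assume "1 \<le> s" "s \<le> k" "p + s \<le> n"
    have kernel: "fdet s (\<lambda>i j. gauss_kernel x (\<gamma> ! i) (\<beta> ! j)) > 0"
      if "\<gamma> \<in> incr_seqs s n" for \<gamma>
      using \<open>x > 1\<close> \<open>s \<le> k\<close> incr_seqs_nth_less[OF that] incr_seqs_nth_less[OF \<beta>]
      by (intro fdet_gauss_kernel_pos) auto
    \<comment> \<open>In the Cauchy-Binet sum all terms are nonnegative; the one whose columns match
      the rows \<open>p, ..., p + s - 1\<close> is strictly positive by \<open>pos\<close>.\<close>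
    have "[p..<p + s] \<in> incr_seqs s n"
      using \<open>p + s \<le> n\<close> by (auto simp: incr_seqs_def)
    moreover have "fdet s (\<lambda>i j. r (p + i) ([p..<p + s] ! j)) > 0"
      using pos[OF \<open>p + s \<le> n\<close>] by (subst fdet_cong[where g="\<lambda>i j. r (p + i) (p + j)"]) auto
    ultimately have "(\<Sum>\<gamma>\<in>incr_seqs s n. fdet s (\<lambda>i j. r (p + i) (\<gamma> ! j)) *
        fdet s (\<lambda>i j. gauss_kernel x (\<gamma> ! i) (\<beta> ! j))) > 0"
      using nonneg[OF \<open>p + s \<le> n\<close>] kernel
      by (intro sum_pos2[of _ "[p..<p + s]"] finite_incr_seqs mult_pos_pos mult_nonneg_nonneg)
        (auto intro: less_imp_le)
    then show "fdet s (\<lambda>i j. M x (p + i) (\<beta> ! j)) > 0"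
      unfolding M_def
      using fdet_Cauchy_Binet[of s "\<lambda>i. r (p + i)" "\<lambda>l j. gauss_kernel x l (\<beta> ! j)" n] by simp
  qed (use incr_seqs_nth_less[OF \<alpha>] incr_seqs_nth_bound[OF \<alpha>] in auto)
  have "((\<lambda>x. fdet k (\<lambda>i j. M x (\<alpha> ! i) (\<beta> ! j))) \<longlongrightarrow> fdet k (\<lambda>i j. r (\<alpha> ! i) (\<beta> ! j))) at_top"
  proof (rule tendsto_fdet)
    fix i j assume "j < k"
    have "((\<lambda>x. M x (\<alpha> ! i) (\<beta> ! j)) \<longlongrightarrow>
        (\<Sum>l<n. r (\<alpha> ! i) l * (if l = \<beta> ! j then 1 else 0))) at_top"
      unfolding M_def by (intro tendsto_sum tendsto_mult tendsto_const tendsto_gauss_kernel)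
    then show "((\<lambda>x. M x (\<alpha> ! i) (\<beta> ! j)) \<longlongrightarrow> r (\<alpha> ! i) (\<beta> ! j)) at_top"
      using incr_seqs_nth_bound[OF \<beta> \<open>j < k\<close>] by (simp add: if_distrib cong: if_cong)
  qed
  moreover have "\<forall>\<^sub>F x in at_top. fdet k (\<lambda>i j. M x (\<alpha> ! i) (\<beta> ! j)) \<ge> 0"
    using eventually_gt_at_top[of 1] by eventually_elim (use M_pos in \<open>auto intro: less_imp_le\<close>)
  ultimately show ?thesis
    by (rule tendsto_lowerbound) simp
qed

section \<open>Staircase matrices and triangular factors\<close>

lemma det_submat:
  assumes "A \<in> carrier_mat m n" and "\<alpha> \<in> incr_seqs k m" and "\<beta> \<in> incr_seqs k n"
  shows "det (submat A \<alpha> \<beta>) = fdet k (\<lambda>i j. A $$ (\<alpha> ! i, \<beta> ! j))"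
  unfolding submat_eq[OF assms] fdet_def ..

lemma type_I_staircase_lower:
  assumes "type_I_staircase A" "A \<in> carrier_mat m n"
    and "A $$ (i, j) = 0" "j < i" "j < n" "i \<le> k" "k < m" "l \<le> j"
  shows "A $$ (k, l) = 0"
proof -
  have "i < m" "l < n"
    using assms by auto
  moreover note assms(1)[unfolded type_I_staircase_def carrier_matD[OF assms(2)],
      THEN conjunct2, THEN conjunct1, rule_format, of i j k l]
  ultimately show ?thesis
    using assms(3-) by simp
qed

lemma type_I_staircase_upper:
  assumes "type_I_staircase A" "A \<in> carrier_mat m n"
    and "A $$ (i, j) = 0" "i < j" "i < m" "k \<le> i" "j \<le> l" "l < n"
  shows "A $$ (k, l) = 0"
proof -
  have "k < m" "j < n"
    using assms by auto
  moreover note assms(1)[unfolded type_I_staircase_def carrier_matD[OF assms(2)],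
      THEN conjunct2, THEN conjunct2, rule_format, of i j k l]
  ultimately show ?thesis
    using assms(3-) by simp
qed

lemma type_I_staircase_diag:
  assumes "type_I_staircase A" "A \<in> carrier_mat m n" "i < m" "i < n"
  shows "A $$ (i, i) \<noteq> 0"
  using assms(1)[unfolded type_I_staircase_def carrier_matD[OF assms(2)], THEN conjunct1] assms(3,4)
  by simp

text \<open>A zero on the diagonal of the submatrix lies off the diagonal of \<open>A\<close>, so
  the staircase shape spreads it to a corner block large enough for
  \<open>fdet_zero_block\<close>.\<close>

lemma staircase_fdet_trivial:
  assumes "type_I_staircase A" "A \<in> carrier_mat m n" "m \<ge> n"
    and \<alpha>: "\<alpha> \<in> incr_seqs k m" and \<beta>: "\<beta> \<in> incr_seqs k n"
    and "\<not> nontrivial A \<alpha> \<beta>"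
  shows "fdet k (\<lambda>i j. A $$ (\<alpha> ! i, \<beta> ! j)) = 0"
proof -
  obtain s where s: "s < k" "A $$ (\<alpha> ! s, \<beta> ! s) = 0"
    using assms(6) \<alpha> by (auto simp: nontrivial_def incr_seqs_def)
  have bounds: "\<alpha> ! i < m" "\<beta> ! i < n" if "i < k" for i
    using incr_seqs_nth_bound[OF \<alpha> that] incr_seqs_nth_bound[OF \<beta> that] by auto
  have mono: "\<alpha> ! i \<le> \<alpha> ! j" "\<beta> ! i \<le> \<beta> ! j" if "i \<le> j" "j < k" for i j
    using incr_seqs_nth_less[OF \<alpha>, of i j] incr_seqs_nth_less[OF \<beta>, of i j] that
    by (cases "i = j"; simp)+
  consider "\<beta> ! s < \<alpha> ! s" | "\<alpha> ! s < \<beta> ! s"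
    using s type_I_staircase_diag[OF assms(1,2), of "\<beta> ! s"] bounds[OF s(1)]
    by (metis linorder_neqE_nat)
  then show ?thesis
  proof cases
    case 1
    show ?thesis
    proof (rule fdet_zero_block[OF s(1)])
      fix i j assume "s \<le> i" "i < k" "j \<le> s"
      then show "A $$ (\<alpha> ! i, \<beta> ! j) = 0"
        using s bounds mono[of s i] mono[of j s]
        by (intro type_I_staircase_lower[OF assms(1,2) s(2) 1]) auto
    qed
  next
    case 2
    \<comment> \<open>Here the zero block is at the upper right; transposing moves it to the lower
      left.\<close>
    have "fdet k (\<lambda>i j. A $$ (\<alpha> ! j, \<beta> ! i)) = 0"
    proof (rule fdet_zero_block[OF s(1)])
      fix i j assume "s \<le> i" "i < k" "j \<le> s"
      then show "A $$ (\<alpha> ! j, \<beta> ! i) = 0"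
        using s bounds mono[of s i] mono[of j s]
        by (intro type_I_staircase_upper[OF assms(1,2) s(2) 2]) auto
    qed
    then show ?thesis
      using fdet_transpose[of k "\<lambda>i j. A $$ (\<alpha> ! i, \<beta> ! j)"] by simp
  qed
qed

text \<open>\<open>ASSR\<close> controls the nontrivial minors and the trivial ones vanish, which
  leaves a weak sign condition on all minors, as Cauchy-Binet requires.\<close>

lemma ASSR_fdet_nonneg:
  assumes "ASSR \<epsilon> A" "type_I_staircase A" "A \<in> carrier_mat m n" "m \<ge> n" "1 \<le> k" "k \<le> n"
    and "\<alpha> \<in> incr_seqs k m" "\<beta> \<in> incr_seqs k n"
  shows "\<epsilon> k * fdet k (\<lambda>i j. A $$ (\<alpha> ! i, \<beta> ! j)) \<ge> 0"
proof (cases "nontrivial A \<alpha> \<beta>")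
  case True
  then have "\<epsilon> k * det (submat A \<alpha> \<beta>) > 0"
    using assms(1,3-) by (auto simp: ASSR_def)
  then show ?thesis
    by (simp add: det_submat[OF assms(3,7,8)])
next
  case False
  then show ?thesis
    by (simp add: staircase_fdet_trivial[OF assms(2,3,4,7,8)])
qed

section \<open>Gram matrices and total positivity of the triangular factor\<close>

text \<open>By Cauchy-Binet the minor is a sum of products of two minors of \<open>a\<close> of the
  same order; their common sign \<open>e\<close> cancels.\<close>

lemma Gram_fdet_nonneg:
  fixes a :: "nat \<Rightarrow> nat \<Rightarrow> real"
  assumes sgn: "e \<in> {1, -1}"
    and minors: "\<And>\<gamma> \<delta>. \<gamma> \<in> incr_seqs k m \<Longrightarrow> \<delta> \<in> incr_seqs k n \<Longrightarrow>
      e * fdet k (\<lambda>i j. a (\<gamma> ! i) (\<delta> ! j)) \<ge> 0"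
    and "\<alpha> \<in> incr_seqs k n" "\<beta> \<in> incr_seqs k n"
  shows "fdet k (\<lambda>i j. \<Sum>l<m. a l (\<alpha> ! i) * a l (\<beta> ! j)) \<ge> 0"
proof -
  have nonneg: "fdet k (\<lambda>i j. a (\<gamma> ! j) (\<alpha> ! i)) * fdet k (\<lambda>i j. a (\<gamma> ! i) (\<beta> ! j)) \<ge> 0"
    if \<gamma>: "\<gamma> \<in> incr_seqs k m" for \<gamma>
  proof -
    have "0 \<le> (e * fdet k (\<lambda>i j. a (\<gamma> ! i) (\<alpha> ! j))) * (e * fdet k (\<lambda>i j. a (\<gamma> ! i) (\<beta> ! j)))"
      using \<gamma> assms(3,4) by (intro mult_nonneg_nonneg minors)
    also have "\<dots> = e * e * (fdet k (\<lambda>i j. a (\<gamma> ! i) (\<alpha> ! j)) * fdet k (\<lambda>i j. a (\<gamma> ! i) (\<beta> ! j)))"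
      by (simp only: mult_ac)
    also have "e * e = 1"
      using sgn by auto
    also have "fdet k (\<lambda>i j. a (\<gamma> ! i) (\<alpha> ! j)) = fdet k (\<lambda>i j. a (\<gamma> ! j) (\<alpha> ! i))"
      by (rule fdet_transpose[symmetric])
    finally show ?thesis
      by simp
  qed
  have "fdet k (\<lambda>i j. \<Sum>l<m. a l (\<alpha> ! i) * a l (\<beta> ! j)) =
      (\<Sum>\<gamma>\<in>incr_seqs k m. fdet k (\<lambda>i j. a (\<gamma> ! j) (\<alpha> ! i)) * fdet k (\<lambda>i j. a (\<gamma> ! i) (\<beta> ! j)))"
    by (rule fdet_Cauchy_Binet)
  also have "\<dots> \<ge> 0"
    by (rule sum_nonneg) (rule nonneg)
  finally show ?thesis .
qed

text \<open>Total nonnegativity passes from \<open>R\<^sup>T R\<close> to the upper triangular factor \<open>R\<close>: the initial rows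
  of \<open>R\<^sup>T R\<close> determine the minors of \<open>R\<close> with initial rows, and prefixing the first \<open>p\<close> rows and
  columns reduces minors with consecutive rows to these.\<close>

lemma Cholesky_fdet_nonneg:
  fixes r :: "nat \<Rightarrow> nat \<Rightarrow> real"
  assumes gram: "\<And>k \<alpha> \<beta>. 1 \<le> k \<Longrightarrow> k \<le> n \<Longrightarrow> \<alpha> \<in> incr_seqs k n \<Longrightarrow> \<beta> \<in> incr_seqs k n \<Longrightarrow>
      fdet k (\<lambda>i j. \<Sum>l<n. r l (\<alpha> ! i) * r l (\<beta> ! j)) \<ge> 0"
    and upper: "\<And>i j. i < n \<Longrightarrow> j < i \<Longrightarrow> r i j = 0"
    and diag: "\<And>i. i < n \<Longrightarrow> r i i > 0"
    and "\<alpha> \<in> incr_seqs k n" "\<beta> \<in> incr_seqs k n"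
  shows "fdet k (\<lambda>i j. r (\<alpha> ! i) (\<beta> ! j)) \<ge> 0"
proof (rule fdet_nonneg_of_consecutive_rows[OF _ _ assms(4,5)])
  have principal: "fdet s (\<lambda>i j. r (p + i) (p + j)) > 0" if "p + s \<le> n" for p s
  proof -
    have "fdet s (\<lambda>i j. r (p + i) (p + j)) = (\<Prod>i<s. r (p + i) (p + i))"
      using that by (intro fdet_upper_triangular upper) auto
    also have "\<dots> > 0"
      using that diag by (intro prod_pos) auto
    finally show ?thesis .
  qed
  then show "fdet s (\<lambda>i j. r (p + i) (p + j)) > 0" if "p + s \<le> n" for p s
    using that .
  have initial: "fdet s (\<lambda>i j. r i (\<gamma> ! j)) \<ge> 0" if s: "s \<le> n" and \<gamma>: "\<gamma> \<in> incr_seqs s n" for s \<gamma>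
  proof (cases "s = 0")
    case False
    have "[0..<s] \<in> incr_seqs s n"
      using s by (auto simp: incr_seqs_def)
    then have "0 \<le> fdet s (\<lambda>i j. \<Sum>l<n. r l ([0..<s] ! i) * r l (\<gamma> ! j))"
      using False s \<gamma> by (intro gram) auto
    \<comment> \<open>As \<open>i < s\<close>, triangularity kills the terms with
      \<open>l \<ge> s\<close>; the remaining sum is a product of square sections.\<close>
    also have "\<dots> = fdet s (\<lambda>i j. \<Sum>l<s. r l i * r l (\<gamma> ! j))"
    proof (rule fdet_cong)
      fix i j assume "i < s"
      then show "(\<Sum>l<n. r l ([0..<s] ! i) * r l (\<gamma> ! j)) = (\<Sum>l<s. r l i * r l (\<gamma> ! j))"
        using s upper by (intro sum.mono_neutral_cong_right) auto
    qed
    also have "\<dots> = fdet s (\<lambda>i l. r l i) * fdet s (\<lambda>l j. r l (\<gamma> ! j))"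
      by (rule fdet_mult)
    also have "fdet s (\<lambda>i l. r l i) = fdet s r"
      by (rule fdet_transpose)
    finally show ?thesis
      using principal[of 0 s] s by (simp add: zero_le_mult_iff)
  qed simp
  show "fdet s (\<lambda>i j. r (p + i) (\<gamma> ! j)) \<ge> 0"
    if ps: "p + s \<le> n" and \<gamma>: "\<gamma> \<in> incr_seqs s n" for p s \<gamma>
  proof (cases "s = 0")
    case False
    show ?thesis
    proof (cases "p \<le> \<gamma> ! 0")
      case True
      \<comment> \<open>With the first \<open>p\<close> columns prefixed, the initial minor of order
        \<open>p + s\<close> is block triangular: a positive principal minor times the minor
        sought.\<close>
      define \<delta> where "\<delta> = [0..<p] @ \<gamma>"
      have "p \<le> x" if x: "x \<in> set \<gamma>" for x
      proof -
        obtain i where "i < s" "x = \<gamma> ! i"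
          using x \<gamma> by (auto simp: in_set_conv_nth incr_seqs_def)
        then show ?thesis
          using incr_seqs_nth_less[OF \<gamma>, of 0 i] True by (cases "i = 0") auto
      qed
      then have \<delta>: "\<delta> \<in> incr_seqs (p + s) n"
        using \<gamma> ps by (auto simp: \<delta>_def incr_seqs_def sorted_wrt_append intro: less_le_trans)
      have nth: "\<delta> ! j = j" if "j < p" for j
        using that by (simp add: \<delta>_def nth_append)
      have nth': "\<delta> ! (p + j) = \<gamma> ! j" for j
        by (simp add: \<delta>_def nth_append)
      have "fdet (p + s) (\<lambda>i j. r i (\<delta> ! j)) =
          fdet p (\<lambda>i j. r i (\<delta> ! j)) * fdet s (\<lambda>i j. r (p + i) (\<delta> ! (p + j)))"
        using ps by (intro fdet_block) (simp add: nth upper)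
      also have "fdet p (\<lambda>i j. r i (\<delta> ! j)) = fdet p r"
        by (rule fdet_cong) (simp add: nth)
      finally show ?thesis
        using initial[OF ps \<delta>] principal[of 0 p] ps by (simp add: nth' zero_le_mult_iff)
    next
      case False
      \<comment> \<open>Column \<open>\<gamma> ! 0\<close> lies left of \<open>p\<close>, so it is
        zero in all rows from \<open>p\<close> on; \<open>s = 0\<close> in
        \<open>fdet_zero_block\<close> means a zero first column.\<close>
      then have "fdet s (\<lambda>i j. r (p + i) (\<gamma> ! j)) = 0"
        using \<open>s \<noteq> 0\<close> ps by (intro fdet_zero_block[of 0] upper) auto
      then show ?thesis
        by simp
    qed
  qed simp
qed

text \<open>The staircase shape is itself a consequence of the minors: nonnegative minors of order 2
  against the positive diagonal force zeros above the diagonal to spread right and up.\<close>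

lemma TP_of_upper_triangular:
  assumes R: "R \<in> carrier_mat n n" and "upper_triangular R" and diag: "\<And>i. i < n \<Longrightarrow> R $$ (i, i) > 0"
    and minors: "\<And>k \<alpha> \<beta>. \<alpha> \<in> incr_seqs k n \<Longrightarrow> \<beta> \<in> incr_seqs k n \<Longrightarrow>
      fdet k (\<lambda>i j. R $$ (\<alpha> ! i, \<beta> ! j)) \<ge> 0"
  shows "TP R"
proof -
  have upper: "R $$ (i, j) = 0" if "j < i" "i < n" for i j
    using assms(2) R that by (auto simp: upper_triangular_def)
  have entry: "R $$ (i, j) \<ge> 0" if "i < n" "j < n" for i j
    using minors[of "[i]" 1 "[j]"] that by (simp add: incr_seqs_def fdet_1)
  have minor2: "R $$ (i, j) * R $$ (i', j') - R $$ (i, j') * R $$ (i', j) \<ge> 0"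
    if "i < i'" "j < j'" "i' < n" "j' < n" for i i' j j'
    using minors[of "[i, i']" 2 "[j, j']"] that by (simp add: incr_seqs_def fdet_2)
  \<comment> \<open>Uses the minor with rows \<open>i, j\<close> and columns \<open>j, l\<close>,
    where only the product through the diagonal entry \<open>(j, j)\<close> survives.\<close>
  have zero_right: "R $$ (i, l) = 0" if "i < j" "R $$ (i, j) = 0" "j \<le> l" "l < n" for i j l
  proof (cases "j = l")
    case False
    then have "R $$ (i, l) * R $$ (j, j) \<le> 0"
      using minor2[of i j j l] that by simp
    then show ?thesis
      using diag[of j] entry[of i l] that by (simp add: mult_le_0_iff)
  qed (use that in simp)
  \<comment> \<open>Likewise with rows \<open>k, i\<close> and columns \<open>i, l\<close>, through
    the diagonal entry \<open>(i, i)\<close>.\<close>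
  have zero_up: "R $$ (k, l) = 0" if "i < l" "R $$ (i, l) = 0" "k \<le> i" "l < n" for i k l
  proof (cases "k = i")
    case False
    then have "R $$ (k, l) * R $$ (i, i) \<le> 0"
      using minor2[of k i i l] that by simp
    then show ?thesis
      using diag[of i] entry[of k l] that by (simp add: mult_le_0_iff)
  qed (use that in simp)
  have "type_I_staircase R"
    unfolding type_I_staircase_def
  proof (intro conjI allI impI; (elim conjE)?)
    show "R $$ (i, i) \<noteq> 0" if "i < min (dim_row R) (dim_col R)" for i
      using diag[of i] that R by simp
    show "R $$ (k, l) = 0" if "k < dim_row R" "j < i" "i \<le> k" "l \<le> j" for i j k l
      using upper[of l k] that R by simp
    show "R $$ (k, l) = 0"
      if "l < dim_col R" "i < j" "R $$ (i, j) = 0" "k \<le> i" "j \<le> l" for i j k l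
      using zero_up[of i l k] zero_right[of i j l] that R by simp
  qed
  moreover have "full_rank R"
  proof -
    have "det R = prod_list (diag_mat R)"
      using det_upper_triangular assms(2) R .
    moreover have "0 \<notin> set (diag_mat R)"
      using diag R by (fastforce simp: diag_mat_def)
    ultimately have "det R \<noteq> 0"
      by (simp add: prod_list_zero_iff)
    then show ?thesis
      using vec_space.det_rank_iff[OF R] R by (simp add: full_rank_def)
  qed
  moreover have "det (submat R \<alpha> \<beta>) \<ge> 0"
    if "\<alpha> \<in> incr_seqs k n" "\<beta> \<in> incr_seqs k n" for k \<alpha> \<beta>
    using minors[OF that] det_submat[OF R that] by simp
  ultimately show ?thesis
    using R by (simp add: TP_def SR_def is_signature_def)
qed

section \<open>Column boundary submatrices and the orthogonal factor\<close>

lemma consec_seqs_nth: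
  assumes "\<alpha> \<in> consec_seqs k n" "i < k"
  shows "\<alpha> ! i = \<alpha> ! 0 + i"
  using assms(2)
proof (induction i)
  case (Suc i)
  then show ?case
    using assms(1) by (auto simp: consec_seqs_def)
qed simp

text \<open>The staircase shape turns the single zero column left of a column boundary submatrix into a
  zero block reaching to the first column, so that \<open>A[\<alpha>|\<beta>] = Q[\<alpha>|\<beta>] R[\<beta>|\<beta>]\<close>.\<close>

lemma col_boundary_left_zero:
  assumes "type_I_staircase A" "A \<in> carrier_mat m n" "m \<ge> n"
    and "col_boundary_submatrix k A \<alpha> \<beta>" "i < k" "l < \<beta> ! 0"
  shows "A $$ (\<alpha> ! i, l) = 0"
proof -
  have *: "k \<ge> 1" "\<alpha> \<in> consec_seqs k m" "\<beta> \<in> consec_seqs k n" "nontrivial A \<alpha> \<beta>"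
      "col_subvec A \<alpha> (\<beta> ! 0 - 1) = 0\<^sub>v k" "\<beta> ! 0 > 0"
    using assms by (auto simp: col_boundary_submatrix_def)
  have len: "length \<alpha> = k"
    using *(2) by (simp add: consec_seqs_def incr_seqs_def)
  let ?a = "\<alpha> ! 0" and ?b = "\<beta> ! 0"
  have bounds: "?a < m" "?b < n" "\<alpha> ! i < m"
    using *(1-3) assms(5) incr_seqs_nth_bound by (auto simp: consec_seqs_def)
  have zero: "A $$ (?a, ?b - 1) = 0"
    using arg_cong[OF *(5), of "\<lambda>v. v $ 0"] *(1) len by (simp add: col_subvec_def)
  have nz: "A $$ (?a, ?b) \<noteq> 0"
    using *(1,4) len by (simp add: nontrivial_def)
  \<comment> \<open>The zero must lie strictly below the diagonal: from above it would spread right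
    to the nonzero entry \<open>(?a, ?b)\<close>, and the diagonal has no zeros.\<close>
  have "\<not> ?a < ?b - 1"
    using type_I_staircase_upper[OF assms(1,2) zero, of ?a ?b] nz bounds by auto
  moreover have "?a \<noteq> ?b - 1"
    using type_I_staircase_diag[OF assms(1,2), of "?b - 1"] zero bounds assms(3) by auto
  ultimately have "?b - 1 < ?a"
    by simp
  moreover have "?a \<le> \<alpha> ! i"
    using consec_seqs_nth[OF *(2) assms(5)] by simp
  ultimately show ?thesis
    using bounds assms(6) by (intro type_I_staircase_lower[OF assms(1,2) zero]) auto
qed

theorem theorem4p8:
  fixes A Q R :: "real mat" and m n :: nat and \<epsilon> :: "nat \<Rightarrow> real"
  assumes "A \<in> carrier_mat m n" and "m \<ge> n" and "vec_space.rank m A = n"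
    and "type_I_staircase A" and "ASSR \<epsilon> A"
    and "Q \<in> carrier_mat m n" and "R \<in> carrier_mat n n" and "A = Q * R"
    and "transpose_mat Q * Q = 1\<^sub>m n"
    and "upper_triangular R" and "\<forall>i < n. R $$ (i, i) > 0"
  shows "TP R \<and>
    (\<forall>k \<alpha> \<beta>. col_boundary_submatrix k A \<alpha> \<beta> \<longrightarrow>
       col_gen_boundary_submatrix k Q \<alpha> \<beta> \<and> \<epsilon> k * det (submat Q \<alpha> \<beta>) > 0)"
proof (intro conjI allI impI)
  note [simp] = carrier_matD[OF assms(1)] carrier_matD[OF assms(6)] carrier_matD[OF assms(7)]
  have upper: "R $$ (i, j) = 0" if "j < i" "i < n" for i j
    using assms(10) that by (auto simp: upper_triangular_def)
  have diag: "R $$ (i, i) > 0" if "i < n" for i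
    using assms(11) that by simp
  have gram: "(\<Sum>l<m. A $$ (l, i) * A $$ (l, j)) = (\<Sum>l<n. R $$ (l, i) * R $$ (l, j))"
    if "i < n" "j < n" for i j
  proof -
    have "transpose_mat A * A = transpose_mat R * transpose_mat Q * (Q * R)"
      unfolding assms(8) transpose_mult[OF assms(6,7)] ..
    also have "\<dots> = transpose_mat R * (transpose_mat Q * (Q * R))"
      using assms(6,7) by (intro assoc_mult_mat[of _ n n _ m _ n] mult_carrier_mat[of _ m n]) auto
    also have "transpose_mat Q * (Q * R) = transpose_mat Q * Q * R"
      using assms(6,7) by (intro assoc_mult_mat[of _ n m _ n _ n, symmetric]) auto
    finally have "transpose_mat A * A = transpose_mat R * R"
      by (simp add: assms(9) left_mult_one_mat[OF assms(7)])
    then have "(transpose_mat A * A) $$ (i, j) = (transpose_mat R * R) $$ (i, j)"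
      by simp
    then show ?thesis
      using that by (simp add: scalar_prod_def lessThan_atLeast0)
  qed
  have R_minors: "fdet k (\<lambda>i j. R $$ (\<alpha> ! i, \<beta> ! j)) \<ge> 0"
    if "\<alpha> \<in> incr_seqs k n" "\<beta> \<in> incr_seqs k n" for k \<alpha> \<beta>
  proof (rule Cholesky_fdet_nonneg[where r="\<lambda>i j. R $$ (i, j)", OF _ upper diag that])
    fix k \<alpha> \<beta> assume k: "1 \<le> k" "k \<le> n" and \<alpha>\<beta>: "\<alpha> \<in> incr_seqs k n" "\<beta> \<in> incr_seqs k n"
    have "\<epsilon> k \<in> {1, -1}"
      using assms(2,5) k by (auto simp: ASSR_def is_signature_def)
    then have "0 \<le> fdet k (\<lambda>i j. \<Sum>l<m. A $$ (l, \<alpha> ! i) * A $$ (l, \<beta> ! j))"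
      using ASSR_fdet_nonneg[OF assms(5,4,1,2) k] \<alpha>\<beta>
      by (rule Gram_fdet_nonneg[where a="\<lambda>i j. A $$ (i, j)"])
    also have "\<dots> = fdet k (\<lambda>i j. \<Sum>l<n. R $$ (l, \<alpha> ! i) * R $$ (l, \<beta> ! j))"
      using incr_seqs_nth_bound \<alpha>\<beta> by (intro fdet_cong gram) auto
    finally show "0 \<le> fdet k (\<lambda>i j. \<Sum>l<n. R $$ (l, \<alpha> ! i) * R $$ (l, \<beta> ! j))" .
  qed
  show "TP R"
    using TP_of_upper_triangular[OF assms(7,10) diag R_minors] by simp
  fix k \<alpha> \<beta> assume bd: "col_boundary_submatrix k A \<alpha> \<beta>"
  then have k: "k \<ge> 1" and \<alpha>: "\<alpha> \<in> consec_seqs k m" and \<beta>: "\<beta> \<in> consec_seqs k n"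
    and nontriv: "nontrivial A \<alpha> \<beta>"
    by (auto simp: col_boundary_submatrix_def)
  have \<alpha>': "\<alpha> \<in> incr_seqs k m" and \<beta>': "\<beta> \<in> incr_seqs k n"
    using \<alpha> \<beta> by (auto simp: consec_seqs_def)
  then have len: "length \<alpha> = k"
    by (simp add: incr_seqs_def)
  let ?b = "\<beta> ! 0"
  have \<alpha>_lt: "\<alpha> ! i < m" if "i < k" for i
    using incr_seqs_nth_bound[OF \<alpha>' that] .
  have bk: "?b + k \<le> n"
    using incr_seqs_nth_bound[OF \<beta>', of "k - 1"] consec_seqs_nth[OF \<beta>, of "k - 1"] k by simp
  have A_entry: "A $$ (i, j) = (\<Sum>l\<le>j. Q $$ (i, l) * R $$ (l, j))" if "i < m" "j < n" for i j
  proof -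
    have "A $$ (i, j) = (\<Sum>l<n. Q $$ (i, l) * R $$ (l, j))"
      unfolding assms(8) using that by (simp add: scalar_prod_def lessThan_atLeast0)
    also have "\<dots> = (\<Sum>l\<le>j. Q $$ (i, l) * R $$ (l, j))"
      using that upper by (intro sum.mono_neutral_right) auto
    finally show ?thesis .
  qed
  \<comment> \<open>Forward substitution: once the earlier columns of \<open>Q\<close> vanish in row
    \<open>\<alpha> ! i\<close>, the zero entry of \<open>A\<close> is
    \<open>Q $$ (\<alpha> ! i, l)\<close> times a positive diagonal entry of
    \<open>R\<close>.\<close>
  have Q_zero: "Q $$ (\<alpha> ! i, l) = 0" if "i < k" "l < ?b" for i l
    using that(2)
  proof (induction l rule: less_induct)
    case (less l)
    have "A $$ (\<alpha> ! i, l) = (\<Sum>q\<le>l. Q $$ (\<alpha> ! i, q) * R $$ (q, l))"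
      using less.prems bk \<alpha>_lt[OF that(1)] by (intro A_entry) auto
    also have "\<dots> = Q $$ (\<alpha> ! i, l) * R $$ (l, l)"
      using less by (subst sum.remove[of _ l]) (auto intro!: sum.neutral)
    finally show ?case
      using col_boundary_left_zero[OF assms(4,1,2) bd that(1) less.prems] diag[of l] less.prems bk
      by simp
  qed
  have A_block: "A $$ (\<alpha> ! i, ?b + j) = (\<Sum>l<k. Q $$ (\<alpha> ! i, ?b + l) * R $$ (?b + l, ?b + j))"
    if "i < k" "j < k" for i j
  proof -
    have "A $$ (\<alpha> ! i, ?b + j) = (\<Sum>q\<le>?b + j. Q $$ (\<alpha> ! i, q) * R $$ (q, ?b + j))"
      using that bk \<alpha>_lt by (intro A_entry) auto
    \<comment> \<open>Terms left of \<open>?b\<close> vanish by \<open>Q_zero\<close>, those beyond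
      \<open>?b + j\<close> by triangularity of \<open>R\<close>, so the range can be taken
      independent of \<open>j\<close>.\<close>
    also have "\<dots> = (\<Sum>q\<in>{?b..<?b + k}. Q $$ (\<alpha> ! i, q) * R $$ (q, ?b + j))"
      using that bk Q_zero[OF that(1)] upper by (intro sum.mono_neutral_cong) auto
    also have "\<dots> = (\<Sum>l<k. Q $$ (\<alpha> ! i, ?b + l) * R $$ (?b + l, ?b + j))"
      using sum.shift_bounds_nat_ivl[of "\<lambda>q. Q $$ (\<alpha> ! i, q) * R $$ (q, ?b + j)" 0 ?b k]
      by (simp add: lessThan_atLeast0 add.commute)
    finally show ?thesis .
  qed
  have "fdet k (\<lambda>i j. A $$ (\<alpha> ! i, \<beta> ! j)) =
      fdet k (\<lambda>i j. \<Sum>l<k. Q $$ (\<alpha> ! i, ?b + l) * R $$ (?b + l, ?b + j))"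
    by (rule fdet_cong, subst consec_seqs_nth[OF \<beta>]) (simp_all add: A_block)
  also have "\<dots> = fdet k (\<lambda>i j. Q $$ (\<alpha> ! i, ?b + j)) * fdet k (\<lambda>i j. R $$ (?b + i, ?b + j))"
    by (rule fdet_mult)
  also have "fdet k (\<lambda>i j. Q $$ (\<alpha> ! i, ?b + j)) = fdet k (\<lambda>i j. Q $$ (\<alpha> ! i, \<beta> ! j))"
    by (rule fdet_cong, subst (2) consec_seqs_nth[OF \<beta>]) simp_all
  also have "fdet k (\<lambda>i j. R $$ (?b + i, ?b + j)) = (\<Prod>i<k. R $$ (?b + i, ?b + i))"
    using bk by (intro fdet_upper_triangular upper) auto
  finally have dets: "det (submat A \<alpha> \<beta>) = det (submat Q \<alpha> \<beta>) * (\<Prod>i<k. R $$ (?b + i, ?b + i))"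
    by (simp add: det_submat[OF assms(1) \<alpha>' \<beta>'] det_submat[OF assms(6) \<alpha>' \<beta>'])
  have "\<epsilon> k * det (submat A \<alpha> \<beta>) > 0"
    using assms(2,5) \<alpha>' \<beta>' nontriv k bk by (auto simp: ASSR_def)
  moreover have "(\<Prod>i<k. R $$ (?b + i, ?b + i)) > 0"
    using bk diag by (intro prod_pos) auto
  ultimately show "\<epsilon> k * det (submat Q \<alpha> \<beta>) > 0"
    unfolding dets by (metis mult.assoc zero_less_mult_pos2)
  \<comment> \<open>The same cancellation at the corner: the entry of \<open>A\<close> there is
    nonzero and equals this entry of \<open>Q\<close> times a diagonal entry of
    \<open>R\<close>.\<close>
  have "Q $$ (\<alpha> ! 0, ?b) \<noteq> 0"
  proof -
    have "A $$ (\<alpha> ! 0, ?b) = (\<Sum>q\<le>?b. Q $$ (\<alpha> ! 0, q) * R $$ (q, ?b))"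
      using k bk \<alpha>_lt by (intro A_entry) auto
    also have "\<dots> = Q $$ (\<alpha> ! 0, ?b) * R $$ (?b, ?b)"
      using Q_zero[of 0] k by (subst sum.remove[of _ ?b]) (auto intro!: sum.neutral)
    finally show ?thesis
      using nontriv k len by (auto simp: nontrivial_def dest!: spec[of _ 0])
  qed
  moreover have "col_subvec Q \<alpha> (?b - 1) = 0\<^sub>v k" if "?b > 0"
    using Q_zero that by (intro eq_vecI) (simp_all add: col_subvec_def len)
  ultimately show "col_gen_boundary_submatrix k Q \<alpha> \<beta>"
    using k \<alpha> \<beta> by (auto simp: col_gen_boundary_submatrix_def)
qed

end
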